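(* Let $P$ be a totally ordered set of basic pieces with a reflexive symmetric dependency relation $\mathscr{C}$, and let $F$ be a heap on $(P,\mathscr{C})$. Let $R(F)$ be the set of racks of $F$, and let $f: R(F)\to R(F)$ be the map sending a rack to the output of the heaps and racks algorithm (defined in the context). Then $f$ is an involution whose only fixed point is the lexicographic rack of $F$. Further, for every $T\in R(F)$, $|\#(T)-\#(f(T))|\leq 1$, with $\#(T)=\#(f(T))$ if and only if $T$ is the lexicographic rack of $F$.
   Context: Heaps. Let $P$ be a set (of basic pieces) and $\mathscr{C}$ a reflexive symmetric relation on $P$ (dependency). A heap on $P$ is $((E,\leq),\epsilon)$ where $(E,\leq)$ is a finite poset and $\epsilon:E\to P$ is a map such that (i) if $\epsilon(a)\mathscr{C}\epsilon(b)$ then $a\le b$ or $b\le a$; (ii) if $b$ covers $a$ then $\epsilon(a)\mathscr{C}\epsilon(b)$. Elements of $E$ are called pieces. A subheap is an induced subposet with the restricted map $\epsilon$. The product $E\odot F$ of heaps $((E,\le),\epsilon)$ and $((F,\le'),\epsilon')$ is the heap on the disjoint union of $E$ and $F$, with map restricting to $\epsilon$ and $\epsilon'$, and with order the transitive closure of $\le$, $\le'$ and the relations $a\leq'' b$ for $a\in E$, $b\in F$ with $\epsilon(a)\mathscr{C}\epsilon(b)$. A trivial heap is a non-empty heap whose distinct pieces have pairwise non-dependent projections. Racks. A rack of a heap $F$ is a decomposition of $F$ into subheaps $(L_0,\ldots,L_{k-1})$, each a (non-empty) trivial heap, such that $F=L_0\odot\cdots\odot L_{k-1}$. The $L_i$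 are its layers ($L_i$ is layer number $i$; layer $i-1$ is the one below layer $i$), and $\#(T)$ denotes the number of layers of a rack $T$. A piece is lonely in a rack if it is the only piece of its layer. Lexicographic order. Given a total order on $P$, the lexicographic order on the pieces of $F$ is the linear order obtained by repeatedly removing the minimal piece of the remaining heap with smallest projection in $P$ (distinct minimal pieces have distinct projections): the first removed piece is first, and so on. The lexicographic rack of $F$ is the rack whose layer $i-1$ consists only of the $i$-th piece in lexicographic order, for $i=1,\ldots,|F|$. Heaps and racks algorithm, applied to a rack $T$ of $F$: (1) Label the pieces $0,1,2,\ldots$ according to the lexicographic order. (2) The transfer set consists of all pieces that are not lonely in $T$, together with all lonely pieces whose label differs from the number of their layer. If it is non-empty, the transfer piece is the piece of the transfer set with smallest label. (3) If the transfer set is empty, output $T$. (4) Otherwise, if the transfer piece is lonely, move it into the layer just below its layer (its old layer, now empty, disappears); if it is not lonely, remove it from its layer and create a new layer, immediately above its old layer, containing only the transfer piece. Output the result. *)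

theory Defs
  imports Main "HOL-Library.FuncSet"
begin

record ('a, 'p) heap =
  pieces :: "'a set"
  ord_rel :: "('a \<times> 'a) set"
  proj :: "'a \<Rightarrow> 'p"

definition covers :: "('a, 'p) heap \<Rightarrow> 'a \<Rightarrow> 'a \<Rightarrow> bool" where
  "covers H b a \<longleftrightarrow> (a, b) \<in> ord_rel H \<and> a \<noteq> b \<and>
     (\<forall>c. (a, c) \<in> ord_rel H \<and> (c, b) \<in> ord_rel H \<longrightarrow> c = a \<or> c = b)"

(* The projection is kept extensional (undefined outside the pieces), and the
   order relation contains only pairs of pieces, so that equality of records is
   exactly equality of heaps. *)
definition is_heap :: "'p set \<Rightarrow> 'p rel \<Rightarrow> ('a, 'p) heap \<Rightarrow> bool" where
  "is_heap P C H \<longleftrightarrow>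
     finite (pieces H) \<and>
     partial_order_on (pieces H) (ord_rel H) \<and>
     proj H \<in> pieces H \<rightarrow>\<^sub>E P \<and>
     (\<forall>a\<in>pieces H. \<forall>b\<in>pieces H. (proj H a, proj H b) \<in> C \<longrightarrow>
        (a, b) \<in> ord_rel H \<or> (b, a) \<in> ord_rel H) \<and>
     (\<forall>a\<in>pieces H. \<forall>b\<in>pieces H. covers H b a \<longrightarrow> (proj H a, proj H b) \<in> C)"

definition subheap :: "('a, 'p) heap \<Rightarrow> 'a set \<Rightarrow> ('a, 'p) heap" where
  "subheap H S =
     \<lparr>pieces = S, ord_rel = ord_rel H \<inter> S \<times> S, proj = restrict (proj H) S\<rparr>"

definition empty_heap :: "('a, 'p) heap" where
  "empty_heap = \<lparr>pieces = {}, ord_rel = {}, proj = (\<lambda>_. undefined)\<rparr>"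

(* Meaningful only for heaps with disjoint sets of pieces, the only case used:
   the union below is then the disjoint union. *)
definition heap_prod ::
  "'p rel \<Rightarrow> ('a, 'p) heap \<Rightarrow> ('a, 'p) heap \<Rightarrow> ('a, 'p) heap" where
  "heap_prod C G H =
     \<lparr>pieces = pieces G \<union> pieces H,
      ord_rel = (ord_rel G \<union> ord_rel H \<union>
        {(a, b). a \<in> pieces G \<and> b \<in> pieces H \<and> (proj G a, proj H b) \<in> C})\<^sup>+,
      proj = (\<lambda>x. if x \<in> pieces G then proj G x else proj H x)\<rparr>"

definition heap_prod_list :: "'p rel \<Rightarrow> ('a, 'p) heap list \<Rightarrow> ('a, 'p) heap" where
  "heap_prod_list C Hs = foldr (heap_prod C) Hs empty_heap"

definition trivial_heap :: "'p set \<Rightarrow> 'p rel \<Rightarrow> ('a, 'p) heap \<Rightarrow> bool" where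
  "trivial_heap P C H \<longleftrightarrow> is_heap P C H \<and> pieces H \<noteq> {} \<and>
     (\<forall>a\<in>pieces H. \<forall>b\<in>pieces H. a \<noteq> b \<longrightarrow> (proj H a, proj H b) \<notin> C)"

(* A subheap is determined by its set of pieces, so a rack of F is represented by
   the list of the sets of pieces of its layers, layer number 0 first. The empty
   heap has the empty list as its only rack. *)
definition racks :: "'p set \<Rightarrow> 'p rel \<Rightarrow> ('a, 'p) heap \<Rightarrow> 'a set list set" where
  "racks P C F = {T.
     (\<forall>L\<in>set T. L \<subseteq> pieces F \<and> trivial_heap P C (subheap F L)) \<and>
     (\<forall>i<length T. \<forall>j<length T. i \<noteq> j \<longrightarrow> T ! i \<inter> T ! j = {}) \<and>
     F = heap_prod_list C (map (subheap F) T)}"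

definition minimal_pieces :: "('a, 'p) heap \<Rightarrow> 'a set" where
  "minimal_pieces H = {a \<in> pieces H. \<forall>b\<in>pieces H. (b, a) \<in> ord_rel H \<longrightarrow> b = a}"

(* The arg_min is unique: distinct minimal pieces of a heap have distinct projections. *)
definition first_piece :: "('a, 'p::linorder) heap \<Rightarrow> 'a" where
  "first_piece H = arg_min_on (proj H) (minimal_pieces H)"

primrec remove_pieces :: "nat \<Rightarrow> ('a, 'p::linorder) heap \<Rightarrow> 'a list" where
  "remove_pieces 0 H = []"
| "remove_pieces (Suc n) H =
     first_piece H # remove_pieces n (subheap H (pieces H - {first_piece H}))"

definition lex_list :: "('a, 'p::linorder) heap \<Rightarrow> 'a list" where
  "lex_list F = remove_pieces (card (pieces F)) F"

definition lex_rack :: "('a, 'p::linorder) heap \<Rightarrow> 'a set list" where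
  "lex_rack F = map (\<lambda>a. {a}) (lex_list F)"

definition label :: "('a, 'p::linorder) heap \<Rightarrow> 'a \<Rightarrow> nat" where
  "label F a = (THE i. i < length (lex_list F) \<and> lex_list F ! i = a)"

definition layer_no :: "'a set list \<Rightarrow> 'a \<Rightarrow> nat" where
  "layer_no T a = (THE i. i < length T \<and> a \<in> T ! i)"

definition lonely :: "'a set list \<Rightarrow> 'a \<Rightarrow> bool" where
  "lonely T a \<longleftrightarrow> T ! layer_no T a = {a}"

definition transfer_set :: "('a, 'p::linorder) heap \<Rightarrow> 'a set list \<Rightarrow> 'a set" where
  "transfer_set F T =
     {a \<in> pieces F. \<not> lonely T a} \<union>
     {a \<in> pieces F. lonely T a \<and> label F a \<noteq> layer_no T a}"

definition transfer_piece :: "('a, 'p::linorder) heap \<Rightarrow> 'a set list \<Rightarrow> 'a" where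
  "transfer_piece F T = arg_min_on (label F) (transfer_set F T)"

(* In the lonely case the layer number i is positive for every rack, so i - 1 is
   not truncated: all pieces with a label smaller than that of t are lonely in the
   layer numbered by their label, so i is larger than the label of t. *)
definition heaps_and_racks ::
  "('a, 'p::linorder) heap \<Rightarrow> 'a set list \<Rightarrow> 'a set list" where
  "heaps_and_racks F T =
     (if transfer_set F T = {} then T
      else let t = transfer_piece F T; i = layer_no T t in
        if lonely T t
        then take (i - 1) T @ [insert t (T ! (i - 1))] @ drop (Suc i) T
        else take i T @ [T ! i - {t}, {t}] @ drop (Suc i) T)"

end

theory Submission
  imports Defs "HOL-Library.Sublist"
begin

text \<open>
  Condition (ii) on heaps makes every order relation of a finite heap a chain of order relations
  between dependent pieces. The product of the layers of a rack has the reflexive order generated by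
  the relations between dependent pieces of different layers, so a rack of \<open>F\<close> is nothing but an
  ordered partition of the pieces into non-empty antichains of the poset \<open>F\<close> in which no
  piece of a later layer lies below a piece of an earlier one (\<open>racks_iff_layering\<close>). The
  statement thus becomes one about a finite poset with a linear extension
  \<open>x\<^sub>0, x\<^sub>1, \<dots>\<close>, namely the lexicographic order.

  Take a rack \<open>T\<close> other than the lexicographic one, and cut off its longest common prefix
  \<open>{x\<^sub>0}, \<dots>, {x\<^sub>m\<^sub>-\<^sub>1}\<close> with the lexicographic rack. The next piece
  \<open>t = x\<^sub>m\<close> is the transfer piece. It lies in a layer of \<open>T\<close> after this prefix, and since layer
  \<open>m\<close> is not \<open>{t}\<close>, either \<open>t\<close> shares its layer with a non-empty set
  \<open>A\<close> of pieces, or it is alone and the layer \<open>A\<close> below it also comes after the prefix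
  (\<open>rack_cases\<close>). All pieces of \<open>A\<close> come after \<open>t\<close> in the linear extension, so
  none of them is below \<open>t\<close>; hence the layers \<open>A, {t}\<close> may be merged to
  \<open>A \<union> {t}\<close>, and conversely this layer may be split, without leaving the set of racks
  (\<open>split_transfer_layer_iff\<close>). The algorithm exchanges these two forms
  (\<open>transfer_crowded\<close>, \<open>transfer_lonely\<close>): neither the prefix nor \<open>t\<close> changes,
  so applying it twice restores \<open>T\<close>, and each application changes the number of layers by
  exactly one. The lexicographic rack has an empty transfer set and is therefore fixed.
\<close>

text \<open>
  For a partial order \<open>r\<close> on \<open>E\<close>, such lists are the strictly order-preserving maps
  from \<open>E\<close> onto a finite initial segment of the natural numbers, each given by its list of
  fibres. By reflexivity of \<open>r\<close>, the last condition also makes the members of the list disjoint.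
\<close>

definition antichain_layering :: "'a set \<Rightarrow> 'a rel \<Rightarrow> 'a set list \<Rightarrow> bool" where
  "antichain_layering E r T \<longleftrightarrow>
     \<Union> (set T) = E \<and>
     (\<forall>L\<in>set T. L \<noteq> {} \<and> (\<forall>a\<in>L. \<forall>b\<in>L. (a, b) \<in> r \<longrightarrow> a = b)) \<and>
     sorted_wrt (\<lambda>A B. \<forall>a\<in>A. \<forall>b\<in>B. (b, a) \<notin> r) T"

abbreviation singletons :: "'a list \<Rightarrow> 'a set list" where
  "singletons xs \<equiv> map (\<lambda>a. {a}) xs"

section \<open>Racks as layerings by antichains\<close>

text \<open>
  A finite poset is generated by its covering pairs, by induction on the size of the interval
  between the two elements. The relation \<open>s\<close> may be larger than the covering relation, as
  dependency is.
\<close>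

lemma poset_rtrancl_covers:
  assumes fin: "finite E" and po: "partial_order_on E r"
    and cover: "\<And>a b. \<lbrakk>(a, b) \<in> r; a \<noteq> b; \<forall>c. (a, c) \<in> r \<and> (c, b) \<in> r \<longrightarrow> c = a \<or> c = b\<rbrakk>
      \<Longrightarrow> (a, b) \<in> s"
    and "(a, b) \<in> r"
  shows "(a, b) \<in> (r \<inter> s)\<^sup>*"
  using \<open>(a, b) \<in> r\<close>
proof (induction "card {c. (a, c) \<in> r \<and> (c, b) \<in> r}" arbitrary: a b rule: less_induct)
  case less
  have tr: "trans r" and an: "antisym r" and rE: "r \<subseteq> E \<times> E" and rf: "refl_on E r"
    using po by (auto simp: partial_order_on_def preorder_on_def)
  let ?I = "\<lambda>a b. {c. (a, c) \<in> r \<and> (c, b) \<in> r}"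
  have finI: "finite (?I a b)"
    by (rule finite_subset[OF _ fin]) (use rE in auto)
  show ?case
  proof (cases "a = b \<or> (\<forall>c. (a, c) \<in> r \<and> (c, b) \<in> r \<longrightarrow> c = a \<or> c = b)")
    case True
    then show ?thesis using less.prems cover by blast
  next
    case False
    then obtain c where c: "(a, c) \<in> r" "(c, b) \<in> r" "c \<noteq> a" "c \<noteq> b" by blast
    have mem: "a \<in> ?I a b" "b \<in> ?I a b"
      using rf rE less.prems by (auto simp: refl_on_def)
    have "?I a c \<subset> ?I a b"
      using c mem tr an by (auto dest: transD antisymD)
    moreover have "?I c b \<subset> ?I a b"
      using c mem tr an by (auto dest: transD antisymD)
    ultimately have "(a, c) \<in> (r \<inter> s)\<^sup>*" "(c, b) \<in> (r \<inter> s)\<^sup>*"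
      using less.hyps c finI by (meson psubset_card_mono)+
    then show ?thesis by simp
  qed
qed

text \<open>
  Condition (ii) on heaps in the form in which it is used: the order is determined by its
  restriction to dependent pairs.
\<close>

lemma heap_order_generated:
  assumes "is_heap P C H" and "(a, b) \<in> ord_rel H"
  shows "(a, b) \<in> (ord_rel H \<inter> {(x, y). (proj H x, proj H y) \<in> C})\<^sup>*"
proof (rule poset_rtrancl_covers)
  show "finite (pieces H)" and po: "partial_order_on (pieces H) (ord_rel H)"
    using assms by (auto simp: is_heap_def)
  show "(x, y) \<in> {(x, y). (proj H x, proj H y) \<in> C}"
    if "(x, y) \<in> ord_rel H" "x \<noteq> y"
      "\<forall>c. (x, c) \<in> ord_rel H \<and> (c, y) \<in> ord_rel H \<longrightarrow> c = x \<or> c = y" for x y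
  proof -
    have "x \<in> pieces H" "y \<in> pieces H"
      using that po by (auto simp: partial_order_on_def preorder_on_def)
    then show ?thesis
      using that assms(1) by (auto simp: is_heap_def covers_def)
  qed
qed (fact assms(2))

lemma ord_rel_subheap: "ord_rel (subheap H S) = ord_rel H \<inter> S \<times> S"
  by (simp add: subheap_def)

lemma heap_prod_list_Nil [simp]: "heap_prod_list C [] = empty_heap"
  by (simp add: heap_prod_list_def)

lemma heap_prod_list_Cons [simp]:
  "heap_prod_list C (H # Hs) = heap_prod C H (heap_prod_list C Hs)"
  by (simp add: heap_prod_list_def)

lemma pieces_layer_prod [simp]:
  "pieces (heap_prod_list C (map (subheap F) T)) = \<Union> (set T)"
  by (induction T) (auto simp: heap_prod_def subheap_def empty_heap_def)

lemma proj_layer_prod [simp]: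
  "proj (heap_prod_list C (map (subheap F) T)) = restrict (proj F) (\<Union> (set T))"
  by (induction T) (auto simp: heap_prod_def subheap_def empty_heap_def fun_eq_iff)

lemma ord_rel_layer_prod_Cons:
  "ord_rel (heap_prod_list C (map (subheap F) (L # T))) =
     (ord_rel F \<inter> L \<times> L \<union> ord_rel (heap_prod_list C (map (subheap F) T)) \<union>
      {(a, b). a \<in> L \<and> b \<in> \<Union> (set T) \<and> (proj F a, proj F b) \<in> C})\<^sup>+"
  by (simp add: heap_prod_def, rule arg_cong[where f = trancl])
     (auto simp: subheap_def)

lemma layer_prod_field:
  "ord_rel (heap_prod_list C (map (subheap F) T)) \<subseteq> \<Union> (set T) \<times> \<Union> (set T)"
proof (induction T)
  case Nil
  then show ?case by (simp add: empty_heap_def)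
next
  case (Cons L T)
  show ?case
    unfolding ord_rel_layer_prod_Cons
    by (rule trancl_subset_Sigma) (use Cons in auto)
qed

text \<open>
  The generating relations of a product never lead from a later layer back to an earlier one. This
  is what puts the layers of a rack in the right order.
\<close>

lemma layer_prod_upward_closed:
  assumes "sorted_wrt (\<lambda>A B. A \<inter> B = {}) (U @ V)"
    and "(x, y) \<in> ord_rel (heap_prod_list C (map (subheap F) (U @ V)))"
    and "x \<in> \<Union> (set V)"
  shows "y \<in> \<Union> (set V)"
  using assms
proof (induction U arbitrary: x y)
  case Nil
  then show ?case using layer_prod_field[of C F V] by auto
next
  case (Cons L U)
  have dis: "L \<inter> \<Union> (set V) = {}" using Cons.prems by (auto simp: sorted_wrt_append)
  have srt: "sorted_wrt (\<lambda>A B. A \<inter> B = {}) (U @ V)" using Cons.prems by simp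
  have "(x, y) \<in> (ord_rel F \<inter> L \<times> L \<union> ord_rel (heap_prod_list C (map (subheap F) (U @ V))) \<union>
      {(a, b). a \<in> L \<and> b \<in> \<Union> (set (U @ V)) \<and> (proj F a, proj F b) \<in> C})\<^sup>+"
    using Cons.prems(2) by (simp only: append_Cons ord_rel_layer_prod_Cons)
  then show ?case using \<open>x \<in> \<Union> (set V)\<close>
  proof (induction rule: trancl_induct)
    case (base y)
    then show ?case using dis Cons.IH[OF srt] by blast
  next
    case (step y z)
    then have "y \<in> \<Union> (set V)" by blast
    then show ?case using step.hyps(2) dis Cons.IH[OF srt] by blast
  qed
qed

text \<open>
  For dependent pieces, condition (i) on heaps turns \<open>not above\<close> into \<open>below\<close>, so the
  relations added by the product already hold in \<open>F\<close>.
\<close>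

lemma layer_prod_le:
  assumes heap: "is_heap P C F" and "\<Union> (set T) \<subseteq> pieces F"
    and "sorted_wrt (\<lambda>A B. \<forall>a\<in>A. \<forall>b\<in>B. (b, a) \<notin> ord_rel F) T"
  shows "ord_rel (heap_prod_list C (map (subheap F) T)) \<subseteq> ord_rel F"
  using assms(2,3)
proof (induction T)
  case Nil
  then show ?case by (simp add: empty_heap_def)
next
  case (Cons L T)
  have tr: "trans (ord_rel F)"
    using heap by (auto simp: is_heap_def partial_order_on_def preorder_on_def)
  have "(a, b) \<in> ord_rel F"
    if "a \<in> L" "b \<in> \<Union> (set T)" "(proj F a, proj F b) \<in> C" for a b
  proof -
    have "a \<in> pieces F" "b \<in> pieces F" "(b, a) \<notin> ord_rel F"
      using that Cons.prems by auto
    then show ?thesis using heap that(3) unfolding is_heap_def by blast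
  qed
  with Cons have "ord_rel F \<inter> L \<times> L \<union> ord_rel (heap_prod_list C (map (subheap F) T)) \<union>
      {(a, b). a \<in> L \<and> b \<in> \<Union> (set T) \<and> (proj F a, proj F b) \<in> C} \<subseteq> ord_rel F"
    by auto
  from trancl_mono_subset[OF this] show ?case
    unfolding ord_rel_layer_prod_Cons using tr by (simp add: trancl_id)
qed

lemma trans_layer_prod: "trans (ord_rel (heap_prod_list C (map (subheap F) T)))"
  by (cases T) (simp_all add: empty_heap_def heap_prod_def)

text \<open>
  Conversely the product contains all order relations of \<open>F\<close> between dependent pieces, hence by
  \<open>heap_order_generated\<close> the whole order of \<open>F\<close>. The set \<open>E\<close> varies because the
  induction passes to lists of layers that cover only a part of \<open>F\<close>.
\<close>

lemma layer_prod_ge: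
  assumes heap: "is_heap P C F" and "antichain_layering E (ord_rel F) T" and "E \<subseteq> pieces F"
    and "a \<in> E" "b \<in> E" "(a, b) \<in> ord_rel F" "(proj F a, proj F b) \<in> C"
  shows "(a, b) \<in> ord_rel (heap_prod_list C (map (subheap F) T))"
  using assms(2-)
proof (induction T arbitrary: E)
  case Nil
  then show ?case by (simp add: antichain_layering_def)
next
  case (Cons L T)
  have E: "E = L \<union> \<Union> (set T)"
    using Cons.prems by (auto simp: antichain_layering_def)
  have lay: "antichain_layering (\<Union> (set T)) (ord_rel F) T"
    using Cons.prems by (auto simp: antichain_layering_def)
  have "(a, b) \<in> ord_rel F \<inter> L \<times> L \<union> ord_rel (heap_prod_list C (map (subheap F) T)) \<union>
      {(a, b). a \<in> L \<and> b \<in> \<Union> (set T) \<and> (proj F a, proj F b) \<in> C}"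
  proof (cases "b \<in> L")
    case True
    then have "a \<notin> \<Union> (set T)"
      using Cons.prems by (auto simp: antichain_layering_def)
    then show ?thesis using True Cons.prems E by auto
  next
    case False
    then have "b \<in> \<Union> (set T)" using Cons.prems E by auto
    then show ?thesis using Cons.IH[OF lay] Cons.prems E by auto
  qed
  then show ?case unfolding ord_rel_layer_prod_Cons by blast
qed

lemma rack_layers_disjoint:
  assumes heap: "is_heap P C F" and lay: "antichain_layering (pieces F) (ord_rel F) T"
  shows "sorted_wrt (\<lambda>A B. A \<inter> B = {}) T"
proof -
  have srt: "sorted_wrt (\<lambda>A B. \<forall>a\<in>A. \<forall>b\<in>B. (b, a) \<notin> ord_rel F) T"
    and sub: "\<forall>L\<in>set T. L \<subseteq> pieces F"
    using lay by (auto simp: antichain_layering_def)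
  show ?thesis
  proof (rule sorted_wrt_mono_rel[OF _ srt])
    fix A B assume AB: "A \<in> set T" "B \<in> set T" "\<forall>a\<in>A. \<forall>b\<in>B. (b, a) \<notin> ord_rel F"
    have "(x, x) \<in> ord_rel F" if "x \<in> A" for x
      using that AB(1) sub heap
      by (auto simp: is_heap_def partial_order_on_def preorder_on_def refl_on_def)
    then show "A \<inter> B = {}" using AB(3) by blast
  qed
qed

lemma disjoint_nth_iff:
  "(\<forall>i<length T. \<forall>j<length T. i \<noteq> j \<longrightarrow> T ! i \<inter> T ! j = {}) \<longleftrightarrow>
   sorted_wrt (\<lambda>A B. A \<inter> B = {}) T"
proof (intro iffI allI impI)
  fix i j assume "sorted_wrt (\<lambda>A B. A \<inter> B = {}) T" "i < length T" "j < length T" "i \<noteq> j"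
  then show "T ! i \<inter> T ! j = {}"
    by (cases i j rule: linorder_cases) (auto simp: sorted_wrt_iff_nth_less)
qed (simp add: sorted_wrt_iff_nth_less)

text \<open>
  A layer is itself a heap, so a strict relation inside it would produce two distinct dependent
  pieces.
\<close>

lemma layer_antichain:
  assumes triv: "trivial_heap P C (subheap F L)"
    and "a \<in> L" "b \<in> L" "(a, b) \<in> ord_rel F"
  shows "a = b"
proof -
  let ?H = "subheap F L"
  have heap: "is_heap P C ?H" using triv by (simp add: trivial_heap_def)
  have "(a, b) \<in> ord_rel ?H" using assms by (simp add: subheap_def)
  then have "(a, b) \<in> (ord_rel ?H \<inter> {(x, y). (proj ?H x, proj ?H y) \<in> C})\<^sup>*"
    by (rule heap_order_generated[OF heap])
  then show ?thesis
  proof (induction rule: rtrancl_induct)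
    case (step y z)
    then show ?case using triv by (auto simp: trivial_heap_def subheap_def)
  qed simp
qed

lemma partial_order_on_restrict:
  assumes "partial_order_on E r" and "S \<subseteq> E"
  shows "partial_order_on S (r \<inter> S \<times> S)"
  using assms unfolding partial_order_on_def preorder_on_def refl_on_def trans_def antisym_def
  by blast

lemma antichain_trivial_heap:
  assumes heap: "is_heap P C F" and "L \<subseteq> pieces F" "L \<noteq> {}"
    and anti: "\<forall>a\<in>L. \<forall>b\<in>L. (a, b) \<in> ord_rel F \<longrightarrow> a = b"
  shows "trivial_heap P C (subheap F L)"
proof -
  have po: "partial_order_on L (ord_rel F \<inter> L \<times> L)"
    using heap assms(2) by (auto simp: is_heap_def intro!: partial_order_on_restrict[of "pieces F"])
  have "finite L" using heap assms(2) by (auto simp: is_heap_def intro: finite_subset)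
  moreover have "restrict (proj F) L \<in> L \<rightarrow>\<^sub>E P"
    using heap assms(2) by (auto simp: is_heap_def)
  moreover have "\<not> covers (subheap F L) b a" for a b
    using anti by (auto simp: covers_def subheap_def)
  moreover have "(a, b) \<in> ord_rel F \<or> (b, a) \<in> ord_rel F"
    if "a \<in> L" "b \<in> L" "(proj F a, proj F b) \<in> C" for a b
    using that heap assms(2) unfolding is_heap_def by blast
  ultimately show ?thesis
    using po anti assms(3) unfolding trivial_heap_def is_heap_def
    by (simp add: subheap_def) blast
qed

lemma racks_iff_layering:
  assumes heap: "is_heap P C F"
  shows "T \<in> racks P C F \<longleftrightarrow> antichain_layering (pieces F) (ord_rel F) T"
proof
  let ?Q = "heap_prod_list C (map (subheap F) T)"
  assume T: "T \<in> racks P C F"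
  then have F: "F = ?Q" and dis: "sorted_wrt (\<lambda>A B. A \<inter> B = {}) T"
    by (simp_all add: racks_def disjoint_nth_iff)
  have "\<Union> (set T) = pieces F" using arg_cong[OF F, of pieces] by simp
  moreover have "L \<noteq> {}" if "L \<in> set T" for L
    using that T by (auto simp: racks_def trivial_heap_def subheap_def)
  moreover have "a = b" if "L \<in> set T" "a \<in> L" "b \<in> L" "(a, b) \<in> ord_rel F" for L a b
    using that T layer_antichain by (fastforce simp: racks_def)
  moreover have "(b, a) \<notin> ord_rel F"
    if ij: "i < j" "j < length T" and ab: "a \<in> T ! i" "b \<in> T ! j" for i j a b
  proof
    assume "(b, a) \<in> ord_rel F"
    then have ba: "(b, a) \<in> ord_rel ?Q" using arg_cong[OF F, of ord_rel] by simp
    have split: "take (Suc i) T @ drop (Suc i) T = T" by simp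
    have "T ! j \<in> set (drop (Suc i) T)"
      using ij by (auto simp: in_set_conv_nth intro!: exI[of _ "j - Suc i"])
    then have "a \<in> \<Union> (set (drop (Suc i) T))"
      using layer_prod_upward_closed[of "take (Suc i) T" "drop (Suc i) T" b a C F]
        dis ba ab split by auto
    then obtain k where "Suc i + k < length T" "a \<in> T ! (Suc i + k)"
      by (auto simp: in_set_conv_nth less_diff_conv add.commute)
    moreover from this have "T ! i \<inter> T ! (Suc i + k) = {}"
      using dis by (simp add: sorted_wrt_iff_nth_less)
    ultimately show False using ab by auto
  qed
  then have "sorted_wrt (\<lambda>A B. \<forall>a\<in>A. \<forall>b\<in>B. (b, a) \<notin> ord_rel F) T"
    by (simp add: sorted_wrt_iff_nth_less)
  ultimately show "antichain_layering (pieces F) (ord_rel F) T"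
    unfolding antichain_layering_def by blast
next
  let ?Q = "heap_prod_list C (map (subheap F) T)"
  assume lay: "antichain_layering (pieces F) (ord_rel F) T"
  have rE: "ord_rel F \<subseteq> pieces F \<times> pieces F"
    using heap by (auto simp: is_heap_def partial_order_on_def preorder_on_def)
  have un: "\<Union> (set T) = pieces F" using lay by (simp add: antichain_layering_def)
  have dis: "sorted_wrt (\<lambda>A B. A \<inter> B = {}) T" by (rule rack_layers_disjoint[OF heap lay])
  have triv: "L \<subseteq> pieces F \<and> trivial_heap P C (subheap F L)" if "L \<in> set T" for L
    using that lay un by (auto simp: antichain_layering_def intro!: antichain_trivial_heap[OF heap])
  have "ord_rel F = ord_rel ?Q"
  proof
    show "ord_rel ?Q \<subseteq> ord_rel F"
      by (rule layer_prod_le[OF heap]) (use lay un in \<open>auto simp: antichain_layering_def\<close>)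
    show "ord_rel F \<subseteq> ord_rel ?Q"
    proof clarify
      fix a b assume ab: "(a, b) \<in> ord_rel F"
      have sub: "ord_rel F \<inter> {(x, y). (proj F x, proj F y) \<in> C} \<subseteq> ord_rel ?Q"
        using layer_prod_ge[OF heap lay] rE by blast
      have "(a, b) \<in> (ord_rel ?Q)\<^sup>*"
        using rtrancl_mono[OF sub] heap_order_generated[OF heap ab] by blast
      then have "a = b \<or> (a, b) \<in> ord_rel ?Q"
        using trans_layer_prod[of C F T] by (auto simp: rtrancl_eq_or_trancl trancl_id)
      moreover have "(a, a) \<in> ord_rel ?Q"
      proof -
        obtain L where L: "L \<in> set T" "a \<in> L" using ab rE un by blast
        have "(a, a) \<in> ord_rel F" using ab rE heap
          by (auto simp: is_heap_def partial_order_on_def preorder_on_def refl_on_def)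
        have "(a, a) \<in> ord_rel (heap_prod_list C (map (subheap F) T))"
          using L
        proof (induction T)
          case (Cons M T)
          then show ?case
            unfolding ord_rel_layer_prod_Cons using \<open>(a, a) \<in> ord_rel F\<close>
            by (intro r_into_trancl) auto
        qed simp
        then show ?thesis .
      qed
      ultimately show "(a, b) \<in> ord_rel ?Q" by auto
    qed
  qed
  moreover have "pieces F = pieces ?Q" using un by simp
  moreover have "proj F = proj ?Q"
    using heap un by (auto simp: is_heap_def PiE_def extensional_def restrict_def fun_eq_iff)
  ultimately have "F = ?Q" by (intro heap.equality) auto
  then show "T \<in> racks P C F"
    using triv dis by (simp add: racks_def disjoint_nth_iff)
qed

section \<open>The lexicographic order is a linear extension\<close>

lemma minimal_pieces_nonempty:
  assumes "finite (pieces H)" "pieces H \<noteq> {}" "partial_order_on (pieces H) (ord_rel H)"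
  shows "minimal_pieces H \<noteq> {}"
proof -
  have po: "trans (ord_rel H)" "antisym (ord_rel H)" "ord_rel H \<subseteq> pieces H \<times> pieces H"
    using assms(3) by (auto simp: partial_order_on_def preorder_on_def)
  have "acyclic (ord_rel H - Id)"
    using trans_diff_Id[OF po(1,2)] by (simp add: acyclic_def trancl_id)
  moreover have "finite (ord_rel H - Id)"
    using assms(1) po(3) by (meson finite_Diff finite_SigmaI finite_subset)
  ultimately have "wf (ord_rel H - Id)" by (simp add: finite_acyclic_wf)
  then obtain a where "a \<in> pieces H" "\<forall>b. (b, a) \<in> ord_rel H - Id \<longrightarrow> b \<notin> pieces H"
    using assms(2) by (metis wf_eq_minimal ex_in_conv)
  then show ?thesis by (auto simp: minimal_pieces_def)
qed

text \<open>
  The removed piece is minimal in what remains, so nothing removed later lies below it.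
\<close>

lemma remove_pieces_linear_extension:
  fixes H :: "('a, 'p::linorder) heap"
  assumes "finite (pieces H)" "partial_order_on (pieces H) (ord_rel H)" "card (pieces H) = n"
  shows "set (remove_pieces n H) = pieces H \<and> distinct (remove_pieces n H) \<and>
    sorted_wrt (\<lambda>a b. (b, a) \<notin> ord_rel H) (remove_pieces n H)"
  using assms
proof (induction n arbitrary: H)
  case 0
  then show ?case by simp
next
  case (Suc n)
  let ?a = "first_piece H"
  let ?H = "subheap H (pieces H - {?a})"
  have ne: "minimal_pieces H \<noteq> {}"
    using Suc.prems by (intro minimal_pieces_nonempty) auto
  have "finite (minimal_pieces H)" using Suc.prems by (simp add: minimal_pieces_def)
  then have a: "?a \<in> minimal_pieces H"
    unfolding first_piece_def using ne by (rule arg_min_if_finite)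
  have po: "partial_order_on (pieces ?H) (ord_rel ?H)"
    using partial_order_on_restrict[OF Suc.prems(2), of "pieces H - {?a}"]
    by (simp add: subheap_def)
  have "card (pieces ?H) = n" "finite (pieces ?H)"
    using Suc.prems a by (auto simp: subheap_def minimal_pieces_def)
  from Suc.IH[OF this(2) po this(1)]
  have IH: "set (remove_pieces n ?H) = pieces H - {?a}" "distinct (remove_pieces n ?H)"
    "sorted_wrt (\<lambda>a b. (b, a) \<notin> ord_rel ?H) (remove_pieces n ?H)"
    by (auto simp: subheap_def)
  have "sorted_wrt (\<lambda>a b. (b, a) \<notin> ord_rel H) (remove_pieces n ?H)"
    by (rule sorted_wrt_mono_rel[OF _ IH(3)]) (use IH(1) in \<open>auto simp: ord_rel_subheap\<close>)
  then show ?case using IH a by (auto simp: minimal_pieces_def)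
qed

lemma lex_list_linear_extension:
  assumes "is_heap P C F"
  shows "set (lex_list F) = pieces F" "distinct (lex_list F)"
    "sorted_wrt (\<lambda>a b. (b, a) \<notin> ord_rel F) (lex_list F)"
  using remove_pieces_linear_extension[of F] assms by (auto simp: lex_list_def is_heap_def)

lemma label_eq:
  assumes "distinct (lex_list F)" and "lex_list F = ys @ t # zs"
  shows "label F t = length ys"
  unfolding label_def
proof (rule the_equality)
  show "i = length ys" if "i < length (lex_list F) \<and> lex_list F ! i = t" for i
    using that assms by (metis add_Suc_right length_Cons length_append less_add_Suc1 nth_append_length
        nth_eq_iff_index_eq)
qed (use assms in auto)

lemma lex_rack_layering:
  assumes "is_heap P C F"
  shows "antichain_layering (pieces F) (ord_rel F) (lex_rack F)"
  using lex_list_linear_extension[OF assms]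
  by (auto simp: antichain_layering_def lex_rack_def sorted_wrt_map)

section \<open>Moving the transfer piece\<close>

text \<open>
  Splitting and merging only concern the relations between \<open>t\<close> and \<open>A\<close>: both lists ask
  that \<open>t\<close> be below no member of \<open>A\<close>, and the merged layer asks in addition that no
  member of \<open>A\<close> be below \<open>t\<close>.
\<close>

lemma layering_split_iff:
  assumes "t \<notin> A" "A \<noteq> {}" "\<forall>a\<in>A. (a, t) \<notin> r"
  shows "antichain_layering E r (X @ [A, {t}] @ Y) \<longleftrightarrow>
    antichain_layering E r (X @ [insert t A] @ Y)"
  using assms by (auto simp: antichain_layering_def sorted_wrt_append)

lemma layer_no_eq:
  assumes "sorted_wrt (\<lambda>A B. A \<inter> B = {}) (X @ B # Y)" and "a \<in> B"
  shows "layer_no (X @ B # Y) a = length X"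
  unfolding layer_no_def
proof (rule the_equality)
  fix i assume i: "i < length (X @ B # Y) \<and> a \<in> (X @ B # Y) ! i"
  show "i = length X"
  proof (rule ccontr)
    assume "i \<noteq> length X"
    then have "(X @ B # Y) ! i \<inter> B = {}"
      using assms(1)[unfolded disjoint_nth_iff[symmetric], rule_format, of i "length X"] i by simp
    then show False using i assms(2) by auto
  qed
qed (use assms in auto)

lemma mem_transfer_set_iff:
  assumes "sorted_wrt (\<lambda>A B. A \<inter> B = {}) T" and "T = X @ B # Y" and "a \<in> B" and "a \<in> pieces F"
  shows "a \<in> transfer_set F T \<longleftrightarrow> \<not> (B = {a} \<and> label F a = length X)"
proof -
  have "layer_no T a = length X" using layer_no_eq assms(1,2,3) by metis
  moreover have "T ! length X = B" by (simp add: assms(2))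
  ultimately show ?thesis using assms(4) by (auto simp: transfer_set_def lonely_def)
qed

text \<open>
  In the part where a rack agrees with the lexicographic rack, every piece is alone in the layer
  numbered by its label.
\<close>

lemma prefix_not_transfer:
  assumes "distinct (lex_list F)"
    and "sorted_wrt (\<lambda>A B. A \<inter> B = {}) (singletons ys @ W)"
    and "lex_list F = ys @ zs" and "a \<in> set ys"
  shows "a \<notin> transfer_set F (singletons ys @ W)"
proof
  assume tr: "a \<in> transfer_set F (singletons ys @ W)"
  obtain ys1 ys2 where ys: "ys = ys1 @ a # ys2" using assms(4) by (meson split_list)
  have "label F a = length ys1" using label_eq[OF assms(1), of ys1 a "ys2 @ zs"] assms(3) ys by simp
  moreover have "a \<in> pieces F" using tr by (auto simp: transfer_set_def)
  ultimately show False
    using tr mem_transfer_set_iff[OF assms(2), of "singletons ys1" "{a}" "singletons ys2 @ W" a F] ys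
    by simp
qed

lemma lex_rack_fixed:
  assumes heap: "is_heap P C F"
  shows "heaps_and_racks F (lex_rack F) = lex_rack F"
proof -
  note lex = lex_list_linear_extension[OF heap]
  have "a \<notin> transfer_set F (lex_rack F)" if "a \<in> pieces F" for a
    using prefix_not_transfer[of F "lex_list F" "[]" "[]" a] lex that
      rack_layers_disjoint[OF heap lex_rack_layering[OF heap]]
    by (simp add: lex_rack_def)
  then have "transfer_set F (lex_rack F) = {}" by (auto simp: transfer_set_def)
  then show ?thesis by (simp add: heaps_and_racks_def)
qed

text \<open>
  Pieces with a smaller label than \<open>t\<close> lie in the prefix, which is disjoint from the transfer
  set.
\<close>

lemma transfer_piece_eq:
  assumes heap: "is_heap P C F"
    and lay: "antichain_layering (pieces F) (ord_rel F) (singletons ys @ W)"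
    and lex: "lex_list F = ys @ t # zs"
    and t: "t \<in> transfer_set F (singletons ys @ W)"
  shows "transfer_piece F (singletons ys @ W) = t"
proof -
  let ?T = "singletons ys @ W"
  note lin = lex_list_linear_extension[OF heap]
  have lt: "label F t < label F s" if "s \<in> transfer_set F ?T" "s \<noteq> t" for s
  proof -
    have "s \<in> pieces F" using that by (auto simp: transfer_set_def)
    moreover have "s \<notin> set ys"
      using prefix_not_transfer[OF lin(2) rack_layers_disjoint[OF heap lay] lex] that by blast
    ultimately have "s \<in> set zs" using lin(1) lex \<open>s \<noteq> t\<close> by auto
    then obtain us vs where "zs = us @ s # vs" by (meson split_list)
    then have "label F s = length ys + 1 + length us"
      using label_eq[OF lin(2), of "ys @ t # us" s vs] lex by simp
    then show ?thesis using label_eq[OF lin(2) lex] by simp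
  qed
  have "transfer_piece F ?T \<in> transfer_set F ?T \<and> \<not> label F t < label F (transfer_piece F ?T)"
    unfolding transfer_piece_def arg_min_on_def
    by (rule arg_minI[of "\<lambda>x. x \<in> transfer_set F ?T" t]) (use t lt in \<open>auto simp: not_less intro: less_imp_le\<close>)
  then show ?thesis using lt by blast
qed

lemma transfer_crowded:
  assumes heap: "is_heap P C F" and lex: "lex_list F = ys @ t # zs"
    and lay: "antichain_layering (pieces F) (ord_rel F)
      (singletons ys @ U @ [insert t A] @ V)"
    and A: "t \<notin> A" "A \<noteq> {}"
  shows "heaps_and_racks F (singletons ys @ U @ [insert t A] @ V) =
    singletons ys @ U @ [A, {t}] @ V"
proof -
  let ?X = "singletons ys @ U"
  let ?T = "singletons ys @ U @ [insert t A] @ V"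
  have T: "?T = ?X @ insert t A # V" by simp
  note dis = rack_layers_disjoint[OF heap lay]
  have tF: "t \<in> pieces F" using lay by (auto simp: antichain_layering_def)
  have ne: "insert t A \<noteq> {t}" using A by auto
  have tr: "t \<in> transfer_set F ?T"
    using mem_transfer_set_iff[OF dis T _ tF] ne by simp
  have tp: "transfer_piece F ?T = t" by (rule transfer_piece_eq[OF heap lay lex tr])
  have no: "layer_no ?T t = length ?X"
    using layer_no_eq[of ?X "insert t A" V t] dis T by simp
  have "?T ! length ?X = insert t A" unfolding T by (rule nth_append_length)
  moreover from this have "\<not> lonely ?T t" unfolding lonely_def no using ne by simp
  moreover have "transfer_set F ?T \<noteq> {}" using tr by blast
  moreover have "insert t A - {t} = A" using A by auto
  ultimately show ?thesis
    unfolding heaps_and_racks_def Let_def tp no by simp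
qed

lemma transfer_lonely:
  assumes heap: "is_heap P C F" and lex: "lex_list F = ys @ t # zs"
    and lay: "antichain_layering (pieces F) (ord_rel F)
      (singletons ys @ U @ [A, {t}] @ V)"
  shows "heaps_and_racks F (singletons ys @ U @ [A, {t}] @ V) =
    singletons ys @ U @ [insert t A] @ V"
proof -
  let ?X = "singletons ys @ U"
  let ?T = "singletons ys @ U @ [A, {t}] @ V"
  have T: "?T = (?X @ [A]) @ {t} # V" by simp
  note dis = rack_layers_disjoint[OF heap lay]
  have tF: "t \<in> pieces F" using lay by (auto simp: antichain_layering_def)
  have "label F t = length ys"
    by (rule label_eq[OF lex_list_linear_extension(2)[OF heap] lex])
  then have tr: "t \<in> transfer_set F ?T"
    using mem_transfer_set_iff[OF dis T _ tF] by simp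
  have tp: "transfer_piece F ?T = t" by (rule transfer_piece_eq[OF heap lay lex tr])
  have no: "layer_no ?T t = Suc (length ?X)"
    using layer_no_eq[of "?X @ [A]" "{t}" V t] dis T by simp
  have "?T ! Suc (length ?X) = {t}" unfolding T by (simp add: nth_append)
  then have "lonely ?T t" unfolding lonely_def no by simp
  moreover have "transfer_set F ?T \<noteq> {}" using tr by blast
  moreover have "?T ! length ?X = A" by (simp add: nth_append)
  ultimately show ?thesis
    unfolding heaps_and_racks_def Let_def tp no by simp
qed

text \<open>
  Here \<open>ys\<close> lists the pieces of the longest common prefix with the lexicographic rack, and
  \<open>t\<close> is the next piece in lexicographic order.
\<close>

lemma rack_cases:
  assumes heap: "is_heap P C F"
    and lay: "antichain_layering (pieces F) (ord_rel F) T"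
  obtains (lex) "T = lex_rack F"
  | (lonely) ys t zs U A V where "lex_list F = ys @ t # zs" "t \<notin> A" "A \<noteq> {}"
      "T = singletons ys @ U @ [A, {t}] @ V"
  | (crowded) ys t zs U A V where "lex_list F = ys @ t # zs" "t \<notin> A" "A \<noteq> {}"
      "T = singletons ys @ U @ [insert t A] @ V"
proof -
  note dis = rack_layers_disjoint[OF heap lay]
  note lin = lex_list_linear_extension[OF heap]
  have un: "\<Union> (set T) = pieces F" and ne: "{} \<notin> set T"
    using lay by (auto simp: antichain_layering_def)
  obtain Q W W' where Q: "T = Q @ W" "lex_rack F = Q @ W'" "W = [] \<or> W' = [] \<or> hd W \<noteq> hd W'"
    using longest_common_prefix[of T "lex_rack F"] by blast
  obtain ys zs' where ys: "lex_list F = ys @ zs'" "Q = singletons ys" "W' = singletons zs'"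
    using Q(2) by (auto simp: lex_rack_def map_eq_append_conv)
  have W: "\<Union> (set W) = set zs'"
  proof -
    have "\<Union> (set W) \<inter> set ys = {}"
      using dis Q(1) ys(2) by (auto simp: sorted_wrt_append)
    moreover have "\<Union> (set W) \<union> set ys = set ys \<union> set zs'"
      using un lin(1) Q(1) ys by auto
    moreover have "set ys \<inter> set zs' = {}" using lin(2) ys(1) by auto
    ultimately show ?thesis by blast
  qed
  show ?thesis
  proof (cases zs')
    case Nil
    then have "W = []" using W ne Q(1) by (cases W) auto
    then show ?thesis using lex Q ys Nil by simp
  next
    case (Cons t zs)
    then obtain B where "B \<in> set W" "t \<in> B" using W by auto
    then obtain U' V where B: "W = U' @ B # V" "t \<in> B" by (meson split_list)
    have xs: "lex_list F = ys @ t # zs" using ys Cons by simp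
    show ?thesis
    proof (cases "B = {t}")
      case True
      \<comment> \<open>otherwise \<open>{t}\<close> would prolong the common prefix\<close>
      have "U' \<noteq> []" using Q(3) B True ys(3) Cons by auto
      then obtain U A where U: "U' = U @ [A]" by (meson rev_exhaust)
      have "t \<notin> A" using dis Q(1) B U by (auto simp: sorted_wrt_append)
      moreover have "A \<noteq> {}" using ne Q(1) B U by auto
      ultimately show ?thesis using lonely[OF xs, of A U V] Q(1) B True U ys by simp
    next
      case False
      have "insert t (B - {t}) = B" "B - {t} \<noteq> {}" using B False by auto
      then show ?thesis using crowded[OF xs, of "B - {t}" U' V] Q(1) B ys by simp
    qed
  qed
qed

text \<open>
  The pieces of \<open>A\<close> are disjoint from the prefix \<open>ys\<close>, so they follow \<open>t\<close> in a
  linear extension of the order and cannot be below \<open>t\<close>.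
\<close>

lemma split_transfer_layer_iff:
  assumes heap: "is_heap P C F" and lex: "lex_list F = ys @ t # zs"
    and A: "t \<notin> A" "A \<noteq> {}"
  shows "antichain_layering (pieces F) (ord_rel F) (singletons ys @ U @ [A, {t}] @ V) \<longleftrightarrow>
    antichain_layering (pieces F) (ord_rel F) (singletons ys @ U @ [insert t A] @ V)"
    (is "?split \<longleftrightarrow> ?merged")
proof -
  note lin = lex_list_linear_extension[OF heap]
  have "\<forall>a\<in>A. (a, t) \<notin> ord_rel F" if "?split \<or> ?merged"
  proof
    fix a assume a: "a \<in> A"
    have "a \<in> pieces F" using that a by (auto simp: antichain_layering_def)
    moreover have "a \<notin> set ys"
      using that a rack_layers_disjoint[OF heap] by (fastforce simp: sorted_wrt_append)
    ultimately have "a \<in> set zs" using lin(1) lex a A(1) by auto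
    then show "(a, t) \<notin> ord_rel F" using lin(3) lex by (auto simp: sorted_wrt_append)
  qed
  then show ?thesis
    using layering_split_iff[OF A, of "ord_rel F" "pieces F" "singletons ys @ U" V] by auto
qed

theorem lemma4:
  fixes P :: "'p::linorder set" and C :: "'p rel" and F :: "('a, 'p) heap"
  assumes "C \<subseteq> P \<times> P" and "refl_on P C" and "sym C"
    and "is_heap P C F"
  shows "heaps_and_racks F \<in> racks P C F \<rightarrow> racks P C F
    \<and> (\<forall>T\<in>racks P C F. heaps_and_racks F (heaps_and_racks F T) = T)
    \<and> {T \<in> racks P C F. heaps_and_racks F T = T} = {lex_rack F}
    \<and> (\<forall>T\<in>racks P C F.
        \<bar>int (length T) - int (length (heaps_and_racks F T))\<bar> \<le> 1
        \<and> (length T = length (heaps_and_racks F T) \<longleftrightarrow> T = lex_rack F))"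
proof -
  let ?f = "heaps_and_racks F"
  note heap = \<open>is_heap P C F\<close>
  note racks = racks_iff_layering[OF heap]
  note fixed = lex_rack_fixed[OF heap]
  have lex_rack: "lex_rack F \<in> racks P C F"
    using racks lex_rack_layering[OF heap] by blast
  have step: "?f T \<in> racks P C F \<and> ?f (?f T) = T \<and>
      \<bar>int (length T) - int (length (?f T))\<bar> = 1" if T: "T \<in> racks P C F" "T \<noteq> lex_rack F" for T
  proof -
    have lay: "antichain_layering (pieces F) (ord_rel F) T" using T(1) racks by blast
    show ?thesis
    proof (cases rule: rack_cases[OF heap lay])
      case 1
      then show ?thesis using T(2) by simp
    next
      case (2 ys t zs U A V)
      have lay': "antichain_layering (pieces F) (ord_rel F) (singletons ys @ U @ [insert t A] @ V)"
        using split_transfer_layer_iff[OF heap 2(1-3)] lay 2(4) by blast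
      have "?f T = singletons ys @ U @ [insert t A] @ V"
        unfolding 2(4) by (rule transfer_lonely[OF heap 2(1) lay[unfolded 2(4)]])
      then show ?thesis
        using transfer_crowded[OF heap 2(1) lay' 2(2,3)] lay' racks 2(4) by simp
    next
      case (3 ys t zs U A V)
      have lay': "antichain_layering (pieces F) (ord_rel F) (singletons ys @ U @ [A, {t}] @ V)"
        using split_transfer_layer_iff[OF heap 3(1-3)] lay 3(4) by blast
      have "?f T = singletons ys @ U @ [A, {t}] @ V"
        unfolding 3(4) by (rule transfer_crowded[OF heap 3(1) lay[unfolded 3(4)] 3(2,3)])
      then show ?thesis
        using transfer_lonely[OF heap 3(1) lay'] lay' racks 3(4) by simp
    qed
  qed
  have "?f T \<in> racks P C F \<and> ?f (?f T) = T \<and> (?f T = T \<longleftrightarrow> T = lex_rack F) \<and>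
      \<bar>int (length T) - int (length (?f T))\<bar> \<le> 1 \<and>
      (length T = length (?f T) \<longleftrightarrow> T = lex_rack F)" if T: "T \<in> racks P C F" for T
  proof (cases "T = lex_rack F")
    case True
    then show ?thesis using fixed lex_rack by simp
  next
    case False
    then show ?thesis using step[OF T False] by auto
  qed
  then show ?thesis using lex_rack by auto
qed

end
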